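(* Let $\mathcal{C}=\{c_1<c_2<\cdots\}$ be an infinite completely greedy coin set. Then \[ \limsup_{N \rightarrow \infty} \frac{ \mathrm{cost}(N \, ; \, \mathcal{C}) }{ \left( \lfloor \log_{2}(N-1) \rfloor + 2 \right) N } \ge \frac{1}{2}. \]
   Context: A coin set is a set of positive integers containing $1$; a sub-coin set is a subset containing $1$. A representation of a positive integer $m$ in $\mathcal{C}$ is $m=\sum_{c\in\mathcal{C}}\alpha_c c$ with $\alpha_c\in\mathbb{N}$; it is minimal if $\sum_c\alpha_c$ is minimized. The greedy representation repeatedly subtracts the largest coin not exceeding the remaining amount. A finite coin set is greedy if the greedy representation is minimal for every positive integer, and completely greedy if all its sub-coin sets are greedy. An infinite coin set (one with infinitely many elements, enumerated increasingly) is completely greedy if for every finite $n$ its first $n$ elements form a completely greedy coin set. $\mathrm{opt}(k;\mathcal{C})$ is the number of coins in a minimal representation of $k$, and $\mathrm{cost}(N;\mathcal{C}) := \sum_{k=1}^{N} \mathrm{opt}(k;\mathcal{C})$. *)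

theory Defs
  imports Complex_Main "HOL-Library.Multiset" "HOL-Library.Infinite_Set" "HOL-Library.Extended_Real"
begin

definition coin_set :: "nat set \<Rightarrow> bool" where
  "coin_set C \<longleftrightarrow> 0 \<notin> C \<and> 1 \<in> C"

text \<open>The representation \<open>m = \<Sum>\<^sub>c \<alpha>\<^sub>c c\<close> is encoded as the finite multiset of coins in which
  \<open>c\<close> has multiplicity \<open>\<alpha>\<^sub>c\<close>; for infinite \<open>C\<close> this makes the finiteness of the support explicit.\<close>

definition representation :: "nat set \<Rightarrow> nat \<Rightarrow> nat multiset \<Rightarrow> bool" where
  "representation C m M \<longleftrightarrow> set_mset M \<subseteq> C \<and> sum_mset M = m"

definition minimal_representation :: "nat set \<Rightarrow> nat \<Rightarrow> nat multiset \<Rightarrow> bool" where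
  "minimal_representation C m M \<longleftrightarrow>
     representation C m M \<and> (\<forall>M'. representation C m M' \<longrightarrow> size M \<le> size M')"

lemma Max_coin:
  assumes "coin_set C" "m > 0"
  shows "Max {c \<in> C. c \<le> m} \<in> C" "Max {c \<in> C. c \<le> m} \<le> m" "Max {c \<in> C. c \<le> m} > 0"
proof -
  have "1 \<in> {c \<in> C. c \<le> m}" "finite {c \<in> C. c \<le> m}"
    using assms by (auto simp: coin_set_def)
  then have "Max {c \<in> C. c \<le> m} \<in> {c \<in> C. c \<le> m}"
    by (intro Max_in) auto
  then show "Max {c \<in> C. c \<le> m} \<in> C" "Max {c \<in> C. c \<le> m} \<le> m" "Max {c \<in> C. c \<le> m} > 0"
    using assms by (auto simp: coin_set_def intro: gr0I)
qed

text \<open>The guard \<open>coin_set C\<close> is only there to make the recursion terminate.\<close>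

function greedy_representation :: "nat set \<Rightarrow> nat \<Rightarrow> nat multiset" where
  "greedy_representation C m =
     (if coin_set C \<and> m > 0
      then add_mset (Max {c \<in> C. c \<le> m}) (greedy_representation C (m - Max {c \<in> C. c \<le> m}))
      else {#})"
  by auto
termination
  by (relation "measure snd") (use Max_coin(3) in auto)

declare greedy_representation.simps [simp del]

lemma representation_greedy_representation:
  assumes "coin_set C"
  shows "representation C m (greedy_representation C m)"
proof (induction m rule: less_induct)
  case (less m)
  show ?case
  proof (cases "m = 0")
    case True
    then show ?thesis
      by (simp add: greedy_representation.simps[of C 0] representation_def)
  next
    case False
    then have "m - Max {c \<in> C. c \<le> m} < m"
      using Max_coin(3)[OF assms, of m] by simp
    from less.IH[OF this] show ?thesis
      using False assms Max_coin(1,2)[OF assms, of m]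
      by (simp add: greedy_representation.simps[of C m] representation_def)
  qed
qed

definition greedy :: "nat set \<Rightarrow> bool" where
  "greedy C \<longleftrightarrow> (\<forall>m>0. minimal_representation C m (greedy_representation C m))"

definition fin_completely_greedy :: "nat set \<Rightarrow> bool" where
  "fin_completely_greedy C \<longleftrightarrow> (\<forall>D\<subseteq>C. coin_set D \<longrightarrow> greedy D)"

definition completely_greedy :: "nat set \<Rightarrow> bool" where
  "completely_greedy C \<longleftrightarrow>
     (if finite C then fin_completely_greedy C
      else \<forall>n\<ge>1. fin_completely_greedy (enumerate C ` {..<n}))"

definition opt :: "nat \<Rightarrow> nat set \<Rightarrow> nat" where
  "opt k C = (LEAST n. \<exists>M. representation C k M \<and> size M = n)"

lemma opt_eq_size:
  assumes "minimal_representation C k M"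
  shows "opt k C = size M"
  using assms unfolding opt_def minimal_representation_def
  by (intro Least_equality) auto

definition cost :: "nat \<Rightarrow> nat set \<Rightarrow> nat" where
  "cost N C = (\<Sum>k=1..N. opt k C)"

end

theory Submission
  imports Defs
begin

text \<open>Let \<open>c < c'\<close> be consecutive coins, \<open>m = \<lceil>c' / c\<rceil>\<close> and \<open>r = m c - c'\<close>. Greediness of
  \<open>{1, c, c'}\<close> at the amount \<open>m c\<close> forces \<open>r < m\<close>, so that \<open>c'\<close> is almost a multiple of \<open>c\<close>. As
  \<open>opt k = k div c + opt (k mod c)\<close> for \<open>k < c'\<close>, the average \<open>A\<close> of \<open>opt\<close> below a coin grows by
  \<open>(m - 1) / 2\<close> from \<open>c\<close> to \<open>c'\<close>, up to an error caused by the \<open>r\<close> missing amounts. Since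
  \<open>opt k = o(k)\<close>, this error is eventually at most \<open>\<epsilon> (m - 1)\<close>. Hence
  \<open>A(c') - A(c) \<ge> (1/2 - \<epsilon>) (m - 1) \<ge> (1/2 - \<epsilon>) log\<^sub>2 (c' / c)\<close>, which telescopes to
  \<open>A(c) \<ge> (1/2 - \<epsilon>) log\<^sub>2 c - O(1)\<close> along the coins.\<close>

section \<open>Truncation of coin sets, and greediness of infinite sub-coin sets\<close>

lemma opt_le_size: "representation C k M \<Longrightarrow> opt k C \<le> size M"
  unfolding opt_def by (rule Least_le) blast

lemma representation_le:
  assumes "representation C m M" "c \<in># M"
  shows "c \<le> m"
  using assms unfolding representation_def by (metis sum_mset.remove le_add1)

lemma representation_Int_atMost:
  assumes "m \<le> b"
  shows "representation (D \<inter> {..b}) m M \<longleftrightarrow> representation D m M"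
proof
  assume "representation D m M"
  then show "representation (D \<inter> {..b}) m M"
    using representation_le[of D m M] assms by (force simp: representation_def)
qed (auto simp: representation_def)

lemma greedy_representation_Int_atMost:
  assumes "coin_set D" "m \<le> b"
  shows "greedy_representation (D \<inter> {..b}) m = greedy_representation D m"
  using assms(2)
proof (induction m rule: less_induct)
  case (less m)
  show ?case
  proof (cases "m = 0")
    case True
    then show ?thesis by (simp add: greedy_representation.simps[of _ 0])
  next
    case False
    have eq: "{c \<in> D \<inter> {..b}. c \<le> m} = {c \<in> D. c \<le> m}"
      using less.prems by auto
    have cs: "coin_set (D \<inter> {..b})"
      using assms(1) False less.prems by (auto simp: coin_set_def)
    have "Max {c \<in> D. c \<le> m} > 0"
      using Max_coin(3)[OF assms(1)] False by simp
    then have "greedy_representation (D \<inter> {..b}) (m - Max {c \<in> D. c \<le> m})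
        = greedy_representation D (m - Max {c \<in> D. c \<le> m})"
      using False less.prems by (intro less.IH) auto
    then show ?thesis
      using False cs assms(1) eq
      by (simp add: greedy_representation.simps[of _ m])
  qed
qed

text \<open>Complete greediness of \<open>C\<close> only speaks of finite initial segments, whereas
  \<open>D\<close> may be infinite, for instance \<open>C\<close> itself. An amount m involves only
  the coins of \<open>D\<close> up to m, and these lie among the first m + 1 elements of
  \<open>C\<close>, because \<open>enumerate C i\<close> is at least i.\<close>

lemma greedy_sub_coin_set:
  assumes "infinite C" "completely_greedy C" "D \<subseteq> C" "coin_set D"
  shows "greedy D"
  unfolding greedy_def
proof (intro allI impI)
  fix m :: nat assume m: "m > 0"
  have "D \<inter> {..m} \<subseteq> enumerate C ` {..<Suc m}"
  proof
    fix d assume d: "d \<in> D \<inter> {..m}"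
    then obtain i where "enumerate C i = d"
      using assms(1,3) enumerate_Ex by blast
    moreover have "i \<le> enumerate C i"
      using assms(1) by (rule le_enumerate)
    ultimately show "d \<in> enumerate C ` {..<Suc m}"
      using d by force
  qed
  moreover have "fin_completely_greedy (enumerate C ` {..<Suc m})"
    using assms(1,2) unfolding completely_greedy_def by simp
  moreover have "coin_set (D \<inter> {..m})"
    using assms(4) m by (auto simp: coin_set_def)
  ultimately have "greedy (D \<inter> {..m})"
    unfolding fin_completely_greedy_def by blast
  then have "minimal_representation (D \<inter> {..m}) m (greedy_representation (D \<inter> {..m}) m)"
    using m unfolding greedy_def by blast
  then show "minimal_representation D m (greedy_representation D m)"
    by (simp add: minimal_representation_def representation_Int_atMost
        greedy_representation_Int_atMost[OF assms(4)])
qed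

section \<open>The constraint imposed by three coins\<close>

lemma size_representation_below_second_coin:
  assumes "representation D r M" "0 \<notin> D" "\<And>d. d \<in> D \<Longrightarrow> d \<le> r \<Longrightarrow> d \<le> 1"
  shows "size M = r"
proof -
  have "\<forall>x\<in>#M. x = 1"
  proof
    fix x assume x: "x \<in># M"
    then have "x \<in> D" using assms(1) by (auto simp: representation_def)
    moreover have "x \<le> r" using representation_le[OF assms(1) x] .
    ultimately show "x = 1"
      using assms(2,3) by (metis One_nat_def le_Suc_eq le_zero_eq)
  qed
  then have "image_mset (\<lambda>x. x) M = image_mset (\<lambda>_. 1) M"
    by (intro image_mset_cong) auto
  then have "sum_mset M = size M"
    by (simp add: size_eq_sum_mset)
  then show ?thesis
    using assms(1) by (simp add: representation_def)
qed

text \<open>The remainder r = m a - b is below a, so greedy pays m a by one b and r ones. Since m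
  copies of a also pay it, 1 + r \<le> m.\<close>

lemma greedy_three_coins:
  assumes "greedy {1, a, b}" "1 < a" "a < b" "b \<le> m * a" "m * a < b + a"
  shows "m * a - b < m"
proof -
  let ?D = "{1, a, b}" and ?r = "m * a - b"
  have cs: "coin_set ?D" using assms by (auto simp: coin_set_def)
  have "m * a > 0" using assms by linarith
  then have "minimal_representation ?D (m * a) (greedy_representation ?D (m * a))"
    using assms(1) unfolding greedy_def by blast
  moreover have "representation ?D (m * a) (replicate_mset m a)"
    by (auto simp: representation_def)
  ultimately have "size (greedy_representation ?D (m * a)) \<le> m"
    unfolding minimal_representation_def by fastforce
  moreover have "Max {c \<in> ?D. c \<le> m * a} = b"
    using assms by (intro Max_eqI) auto
  then have "greedy_representation ?D (m * a) = add_mset b (greedy_representation ?D ?r)"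
    using cs \<open>m * a > 0\<close> by (simp add: greedy_representation.simps[of _ "m * a"])
  moreover have "size (greedy_representation ?D ?r) = ?r"
    by (rule size_representation_below_second_coin[OF representation_greedy_representation[OF cs]])
       (use assms in auto)
  ultimately show ?thesis by simp
qed

section \<open>Recursion and a crude upper bound for \<open>opt\<close>\<close>

lemma opt_0 [simp]: "opt 0 C = 0"
proof -
  have "representation C 0 {#}" by (simp add: representation_def)
  from opt_le_size[OF this] show ?thesis by simp
qed

lemma opt_greedy_step:
  assumes "coin_set C" "greedy C" "k > 0"
  shows "opt k C = Suc (opt (k - Max {c \<in> C. c \<le> k}) C)"
proof -
  have "opt j C = size (greedy_representation C j)" for j
  proof (cases "j = 0")
    case True
    then show ?thesis by (simp add: greedy_representation.simps[of _ 0])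
  next
    case False
    then show ?thesis using assms(2) unfolding greedy_def by (intro opt_eq_size) auto
  qed
  then show ?thesis
    using assms by (simp add: greedy_representation.simps[of _ k])
qed

text \<open>While no larger coin fits, greedy strips copies of c until the residue modulo c is left,
  and greedy counts are optimal.\<close>

lemma opt_div_mod:
  assumes "coin_set C" "greedy C" "c \<in> C" "\<And>d. d \<in> C \<Longrightarrow> d \<le> k \<Longrightarrow> d \<le> c"
  shows "opt k C = k div c + opt (k mod c) C"
  using assms(4)
proof (induction k rule: less_induct)
  case (less k)
  have c: "c > 0" using assms(1,3) by (auto simp: coin_set_def intro: gr0I)
  show ?case
  proof (cases "k < c")
    case False
    have "Max {d \<in> C. d \<le> k} = c"
      using False assms(3) less.prems by (intro Max_eqI) auto
    then have "opt k C = Suc (opt (k - c) C)"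
      using opt_greedy_step[OF assms(1,2), of k] False c by simp
    also have "opt (k - c) C = (k - c) div c + opt ((k - c) mod c) C"
      using False c less.prems by (intro less.IH) auto
    finally show ?thesis
      using False c by (simp add: le_div_geq le_mod_geq)
  qed simp
qed

lemma opt_le_div_add:
  assumes "1 \<in> C" "c \<in> C" "c > 0"
  shows "opt k C \<le> k div c + c"
proof -
  have "representation C k (replicate_mset (k div c) c + replicate_mset (k mod c) 1)"
    using assms by (auto simp: representation_def)
  from opt_le_size[OF this] have "opt k C \<le> k div c + k mod c" by simp
  also have "\<dots> \<le> k div c + c" using assms(3) by (simp add: less_imp_le)
  finally show ?thesis .
qed

section \<open>Growth of the average between consecutive coins\<close>

lemma sum_div_mod:
  fixes f :: "nat \<Rightarrow> real"
  assumes "c > 0"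
  shows "(\<Sum>k<m * c. real (k div c) + f (k mod c))
    = real m * (\<Sum>k<c. f k) + real c * real m * (real m - 1) / 2"
proof (induction m)
  case (Suc m)
  have "(\<Sum>k<Suc m * c. real (k div c) + f (k mod c))
      = (\<Sum>k<m * c. real (k div c) + f (k mod c))
        + (\<Sum>k=m * c..<m * c + c. real (k div c) + f (k mod c))"
    by (simp add: lessThan_atLeast0 sum.atLeastLessThan_concat add.commute)
  \<comment> \<open>On this block of length c the quotient is constantly m and the residues run once
    through 0, ..., c - 1.\<close>
  also have "(\<Sum>k=m * c..<m * c + c. real (k div c) + f (k mod c)) = (\<Sum>k<c. real m + f k)"
    using sum.shift_bounds_nat_ivl[of "\<lambda>k. real (k div c) + f (k mod c)" 0 "m * c" c] assms
    by (auto simp: lessThan_atLeast0 add.commute intro!: sum.cong)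
  finally show ?case
    using Suc.IH by (simp add: sum.distrib field_simps)
qed simp

text \<open>Starting at amount 0 makes the range a full set of residues modulo c, so that blocks of
  length c fit exactly.\<close>

definition avg_opt :: "nat set \<Rightarrow> nat \<Rightarrow> real" where
  "avg_opt C c = (\<Sum>k<c. real (opt k C)) / real c"

text \<open>The sum up to c' is that of m full blocks of length c without its last m c - c' < m
  terms. Full blocks raise the mean by (m - 1) / 2. Each missing term is at most m \<epsilon> c, so
  after division by m c the loss is at most \<epsilon> (m - 1).\<close>

lemma avg_opt_step:
  assumes C: "coin_set C" "greedy C" and c: "c \<in> C" "c > 0"
    and next_coin: "\<And>d. d \<in> C \<Longrightarrow> d < c' \<Longrightarrow> d \<le> c"
    and m: "0 < c'" "c' \<le> m * c" "m * c - c' < m"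
    and small: "\<And>k. k < c \<Longrightarrow> real (opt k C) \<le> \<epsilon> * real c" and \<epsilon>: "1 \<le> \<epsilon> * real c"
  shows "avg_opt C c' \<ge> avg_opt C c + (1 / 2 - \<epsilon>) * (real m - 1)"
proof -
  define g where "g k = real (k div c) + real (opt (k mod c) C)" for k
  have m0: "m > 0" using m by simp
  have "(\<Sum>k<c'. real (opt k C)) = (\<Sum>k<c'. g k)"
  proof (rule sum.cong)
    fix k assume "k \<in> {..<c'}"
    then have "opt k C = k div c + opt (k mod c) C"
      by (intro opt_div_mod C c next_coin) auto
    then show "real (opt k C) = g k" by (simp add: g_def)
  qed simp
  also have "\<dots> = (\<Sum>k<m * c. g k) - (\<Sum>k=c'..<m * c. g k)"
    using m(2) sum.atLeastLessThan_concat[of 0 c' "m * c" g] by (simp add: lessThan_atLeast0)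
  finally have split: "(\<Sum>k<c'. real (opt k C)) = (\<Sum>k<m * c. g k) - (\<Sum>k=c'..<m * c. g k)" .
  have "g k \<le> real m * (\<epsilon> * real c)" if "k \<in> {c'..<m * c}" for k
  proof -
    \<comment> \<open>By 1 \<le> \<epsilon> c the quotient costs at most m - 1 times \<epsilon> c;
      the residue costs at most one more \<epsilon> c.\<close>
    have "k div c < m" using that c(2) by (simp add: less_mult_imp_div_less)
    then have "real (k div c) \<le> (real m - 1) * 1" by simp
    also have "\<dots> \<le> (real m - 1) * (\<epsilon> * real c)"
      using \<epsilon> m0 by (intro mult_left_mono) auto
    finally have "real (k div c) \<le> (real m - 1) * (\<epsilon> * real c)" .
    moreover have "real (opt (k mod c) C) \<le> \<epsilon> * real c"
      using c(2) by (intro small) simp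
    ultimately show ?thesis by (simp add: g_def algebra_simps)
  qed
  then have "(\<Sum>k=c'..<m * c. g k) \<le> real (card {c'..<m * c}) * (real m * (\<epsilon> * real c))"
    by (rule sum_bounded_above)
  also have "\<dots> \<le> (real m - 1) * (real m * (\<epsilon> * real c))"
    using m(3) \<epsilon> by (intro mult_right_mono) auto
  finally have loss: "(\<Sum>k=c'..<m * c. g k) \<le> (real m - 1) * (real m * (\<epsilon> * real c))" .
  have "(\<Sum>k<c'. real (opt k C)) \<ge> real m * (\<Sum>k<c. real (opt k C))
      + real c * real m * (real m - 1) / 2 - (real m - 1) * (real m * (\<epsilon> * real c))"
    using split loss sum_div_mod[OF c(2), of "\<lambda>k. real (opt k C)" m] by (simp add: g_def)
  then have "(\<Sum>k<c'. real (opt k C)) / (real m * real c) \<ge> (real m * (\<Sum>k<c. real (opt k C))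
      + real c * real m * (real m - 1) / 2 - (real m - 1) * (real m * (\<epsilon> * real c))) / (real m * real c)"
    by (rule divide_right_mono) simp
  also have "(real m * (\<Sum>k<c. real (opt k C))
      + real c * real m * (real m - 1) / 2 - (real m - 1) * (real m * (\<epsilon> * real c))) / (real m * real c)
      = avg_opt C c + (1 / 2 - \<epsilon>) * (real m - 1)"
    using m0 c(2) by (simp add: avg_opt_def field_simps)
  \<comment> \<open>As c' \<le> m c, dividing the nonnegative sum by c' instead of m c can only
    increase it.\<close>
  also have "(\<Sum>k<c'. real (opt k C)) / (real m * real c) \<le> avg_opt C c'"
    unfolding avg_opt_def using m(1,2) m0 c(2)
    by (intro divide_left_mono) (auto simp: sum_nonneg simp flip: of_nat_mult)
  finally show ?thesis by simp
qed

text \<open>Turns the gain m - 1 of a step into a logarithm that telescopes; equality holds at m = 1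
  and m = 2.\<close>

lemma log2_le_minus_one:
  assumes "m > 0"
  shows "log 2 (real m) \<le> real m - 1"
proof -
  obtain j where j: "m = Suc j" using assms gr0_implies_Suc by blast
  have "Suc j \<le> 2 ^ j" by (simp add: Suc_leI)
  then have "real m \<le> 2 ^ j"
    unfolding j by (metis of_nat_le_iff of_nat_numeral of_nat_power)
  then have "log 2 (real m) \<le> real j"
    using assms by (simp add: log_le_iff powr_realpow)
  then show ?thesis by (simp add: j)
qed

lemma avg_opt_log_step:
  assumes "coin_set C" "infinite C" "completely_greedy C" "\<epsilon> \<le> 1 / 2" "n > 0"
    and small: "\<And>k. k < enumerate C n \<Longrightarrow> real (opt k C) \<le> \<epsilon> * real (enumerate C n)"
    and \<epsilon>: "1 \<le> \<epsilon> * real (enumerate C n)"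
  shows "avg_opt C (enumerate C (Suc n)) - avg_opt C (enumerate C n)
    \<ge> (1 / 2 - \<epsilon>) * (log 2 (enumerate C (Suc n)) - log 2 (enumerate C n))"
proof -
  define c c' where "c = enumerate C n" and "c' = enumerate C (Suc n)"
  \<comment> \<open>The enumeration starts at index 0, so n > 0 makes c exceed 1, as the three-coin
    bound requires.\<close>
  have "enumerate C 0 \<in> C" using assms(2) by (rule enumerate_in_set)
  then have "enumerate C 0 > 0" using assms(1) by (auto simp: coin_set_def intro: gr0I)
  moreover have "enumerate C 0 < c" unfolding c_def using assms(2,5) by (rule enumerate_mono[rotated])
  ultimately have c: "1 < c" by simp
  have cc': "c < c'" unfolding c_def c'_def using assms(2) by (rule enumerate_step)
  have inC: "c \<in> C" "c' \<in> C" unfolding c_def c'_def using assms(2) by (auto intro: enumerate_in_set)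
  have greedy: "greedy C" using assms by (intro greedy_sub_coin_set) auto
  \<comment> \<open>This is the ceiling of c' / c in natural-number arithmetic.\<close>
  define m where "m = (c' + (c - 1)) div c"
  have "m * c \<le> c' + (c - 1)" unfolding m_def by simp
  then have m_upper: "m * c < c' + c" using c by linarith
  have m_lower: "c' \<le> m * c"
  proof -
    have "(c' + (c - 1)) mod c < c" using c by simp
    moreover have "m * c + (c' + (c - 1)) mod c = c' + (c - 1)" unfolding m_def by simp
    ultimately show ?thesis by linarith
  qed
  have "greedy {1, c, c'}"
    using assms inC c cc' by (intro greedy_sub_coin_set[of C]) (auto simp: coin_set_def)
  then have r: "m * c - c' < m"
    using c cc' m_lower m_upper by (rule greedy_three_coins)
  have "d \<le> c" if d: "d \<in> C" "d < c'" for d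
  proof -
    obtain i where i: "enumerate C i = d" using enumerate_Ex[OF assms(2) d(1)] by blast
    then have "i < Suc n" using d(2) assms(2) unfolding c'_def by auto
    then show ?thesis using i assms(2) unfolding c_def by auto
  qed
  then have step: "avg_opt C c' \<ge> avg_opt C c + (1 / 2 - \<epsilon>) * (real m - 1)"
    using small \<epsilon> c cc' unfolding c_def[symmetric]
    by (intro avg_opt_step assms greedy inC m_lower r) auto
  have "real c' \<le> real m * real c"
    using m_lower by (simp flip: of_nat_mult)
  then have "log 2 c' \<le> log 2 (real m * real c)"
    using c cc' by (intro log_mono) auto
  also have "\<dots> = log 2 m + log 2 c"
    using r c by (simp add: log_mult)
  also have "\<dots> \<le> real m - 1 + log 2 c"
    using log2_le_minus_one r by simp
  finally have "(1 / 2 - \<epsilon>) * (log 2 c' - log 2 c) \<le> (1 / 2 - \<epsilon>) * (real m - 1)"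
    using assms(4) by (intro mult_left_mono) auto
  then show ?thesis using step unfolding c_def c'_def by linarith
qed

section \<open>Asymptotic lower bound for the averages along the coins\<close>

lemma opt_sublinear:
  assumes "coin_set C" "infinite C" "\<epsilon> > 0"
  shows "\<exists>n0. \<forall>n\<ge>n0. \<forall>k\<le>n. real (opt k C) \<le> \<epsilon> * real n"
proof -
  \<comment> \<open>One fixed coin c > 2 / \<epsilon> suffices: the copies of c number at most
    \<epsilon> n / 2, and so do the fewer than c ones once n \<ge> 2 c / \<epsilon>.\<close>
  obtain c where c: "c \<in> C" "c > nat \<lceil>2 / \<epsilon>\<rceil>"
    using assms(2) infinite_nat_iff_unbounded by blast
  then have c': "2 / \<epsilon> < real c" by linarith
  have "real (opt k C) \<le> \<epsilon> * real n" if n: "n \<ge> nat \<lceil>2 * real c / \<epsilon>\<rceil>" "k \<le> n" for n k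
  proof -
    have "opt k C \<le> k div c + c"
      using assms(1) c by (intro opt_le_div_add) (auto simp: coin_set_def)
    then have "real (opt k C) \<le> real (k div c) + real c" by linarith
    also have "real (k div c) \<le> real k / real c" by (rule of_nat_div_le_of_nat)
    also have "\<dots> \<le> real n / real c" using n by (intro divide_right_mono) auto
    also have "\<dots> \<le> \<epsilon> / 2 * real n"
    proof -
      have "2 \<le> \<epsilon> * real c" using c' assms(3) by (simp add: field_simps)
      then have "2 * real n \<le> \<epsilon> * real c * real n" by (intro mult_right_mono) auto
      then show ?thesis using c by (simp add: field_simps)
    qed
    also have "real c \<le> \<epsilon> / 2 * real n"
    proof -
      have "2 * real c / \<epsilon> \<le> real n" using n by linarith
      then show ?thesis using assms(3) by (simp add: field_simps)
    qed
    finally show ?thesis by simp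
  qed
  then show ?thesis by blast
qed

lemma avg_opt_lower_bound:
  assumes "coin_set C" "infinite C" "completely_greedy C" "0 < \<epsilon>" "\<epsilon> \<le> 1 / 2"
  shows "\<exists>n0 K. \<forall>n\<ge>n0. avg_opt C (enumerate C n) \<ge> (1 / 2 - \<epsilon>) * log 2 (enumerate C n) - K"
proof -
  obtain n1 where n1: "\<And>n k. n \<ge> n1 \<Longrightarrow> k \<le> n \<Longrightarrow> real (opt k C) \<le> \<epsilon> * real n"
    using opt_sublinear[OF assms(1,2,4)] by blast
  \<comment> \<open>From n0 on the index is positive, and since \<open>enumerate C n\<close> is at
    least n, both smallness conditions of \<open>avg_opt_log_step\<close> hold. The constant K is
    the initial deficit, making the bound an equality at n0.\<close>
  define n0 where "n0 = max (Suc n1) (nat \<lceil>1 / \<epsilon>\<rceil>)"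
  define K where "K = (1 / 2 - \<epsilon>) * log 2 (enumerate C n0) - avg_opt C (enumerate C n0)"
  have "avg_opt C (enumerate C n) \<ge> (1 / 2 - \<epsilon>) * log 2 (enumerate C n) - K" if "n \<ge> n0" for n
    using that
  proof (induction n rule: dec_induct)
    case base
    show ?case by (simp add: K_def)
  next
    case (step n)
    have n: "n \<le> enumerate C n" using assms(2) by (rule le_enumerate)
    have "1 / \<epsilon> \<le> real (enumerate C n)" using n step.hyps unfolding n0_def by linarith
    then have "1 \<le> \<epsilon> * real (enumerate C n)" using assms(4) by (simp add: field_simps)
    moreover have "real (opt k C) \<le> \<epsilon> * real (enumerate C n)" if "k < enumerate C n" for k
      using n1 n step.hyps that unfolding n0_def by simp
    ultimately have "avg_opt C (enumerate C (Suc n)) - avg_opt C (enumerate C n)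
      \<ge> (1 / 2 - \<epsilon>) * (log 2 (enumerate C (Suc n)) - log 2 (enumerate C n))"
      using step.hyps assms by (intro avg_opt_log_step) (auto simp: n0_def)
    then show ?case using step.IH by (simp add: algebra_simps)
  qed
  then show ?thesis by blast
qed

section \<open>From averages to the limit superior of the cost ratio\<close>

lemma avg_opt_le_cost: "avg_opt C N \<le> real (cost N C) / real N"
proof -
  \<comment> \<open>The ranges differ by one: amount 0 costs nothing, and amount N only adds to the
    cost.\<close>
  have "(\<Sum>k<N. opt k C) \<le> (\<Sum>k\<le>N. opt k C)" by (intro sum_mono2) auto
  also have "\<dots> = cost N C"
    unfolding cost_def by (intro sum.mono_neutral_right) (auto simp: Suc_le_eq)
  finally have "(\<Sum>k<N. real (opt k C)) \<le> real (cost N C)"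
    by (simp flip: of_nat_sum)
  then show ?thesis unfolding avg_opt_def by (intro divide_right_mono) auto
qed

lemma frequently_cost_ratio_ge:
  assumes "coin_set C" "infinite C" "completely_greedy C" "y < 1 / 2"
  shows "\<exists>\<^sub>F N in sequentially.
    y \<le> real (cost N C) / ((real_of_int \<lfloor>log 2 (real N - 1)\<rfloor> + 2) * real N)"
proof -
  \<comment> \<open>Half of the gap between y and 1 / 2, capped at 1 / 2, leaves a positive margin
    \<delta> in the coefficient of the logarithm.\<close>
  define \<epsilon> where "\<epsilon> = min (1 / 2) ((1 / 2 - y) / 2)"
  have \<epsilon>: "0 < \<epsilon>" "\<epsilon> \<le> 1 / 2" "y < 1 / 2 - \<epsilon>"
    using assms(4) by (auto simp: \<epsilon>_def min_def field_simps)
  obtain n0 K where bound: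
    "\<And>n. n \<ge> n0 \<Longrightarrow> avg_opt C (enumerate C n) \<ge> (1 / 2 - \<epsilon>) * log 2 (enumerate C n) - K"
    using avg_opt_lower_bound[OF assms(1-3) \<epsilon>(1,2)] by blast
  define \<delta> where "\<delta> = 1 / 2 - \<epsilon> - y"
  have \<delta>: "\<delta> > 0" using \<epsilon>(3) by (simp add: \<delta>_def)
  \<comment> \<open>Once the binary logarithm of N reaches L, the margin \<delta> times it absorbs K
    and the error 2 \<bar>y\<bar> from the summand 2 in the denominator.\<close>
  define L where "L = max 0 ((K + 2 * \<bar>y\<bar>) / \<delta>)"
  show ?thesis
    unfolding frequently_sequentially
  proof
    fix N0 :: nat
    define n where "n = Max {n0, N0, 3, nat \<lceil>2 powr L\<rceil>}"
    define N where "N = enumerate C n"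
    have "n \<le> N" unfolding N_def using assms(2) by (rule le_enumerate)
    moreover have "n \<ge> n0" "n \<ge> N0" "n \<ge> 3" "n \<ge> nat \<lceil>2 powr L\<rceil>"
      unfolding n_def by (rule Max_ge; simp)+
    ultimately have N: "N \<ge> N0" "N \<ge> 3" "2 powr L \<le> real N" by linarith+
    define D where "D = real_of_int \<lfloor>log 2 (real N - 1)\<rfloor> + 2"
    have l: "L \<le> log 2 N" using N by (simp add: le_log_iff)
    have "0 \<le> log 2 (real N - 1)" using N by simp
    then have "D \<ge> 2" by (simp add: D_def)
    have "log 2 (real N - 1) \<le> log 2 N" using N by simp
    then have D_le: "D \<le> log 2 N + 2" unfolding D_def by linarith
    have "y * D \<le> y * log 2 N + 2 * \<bar>y\<bar>"
    proof (cases "y \<ge> 0")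
      case True
      then have "y * D \<le> y * (log 2 N + 2)" using D_le by (intro mult_left_mono) auto
      then show ?thesis using True by (simp add: algebra_simps)
    next
      case False
      \<comment> \<open>For negative y a lower bound on D is required; it comes from N \<le> 2 (N -
        1) and the floor losing less than 1.\<close>
      have "log 2 N \<le> log 2 (2 * (real N - 1))" using N by (intro log_mono) auto
      also have "\<dots> = 1 + log 2 (real N - 1)" using N by (subst log_mult) auto
      also have "\<dots> \<le> D" unfolding D_def by linarith
      finally have "y * D \<le> y * log 2 N" using False by (intro mult_left_mono_neg) auto
      then show ?thesis by simp
    qed
    also have "2 * \<bar>y\<bar> \<le> \<delta> * log 2 N - K"
    proof -
      have "(K + 2 * \<bar>y\<bar>) / \<delta> \<le> log 2 N" using l by (simp add: L_def)
      then show ?thesis using \<delta> by (simp add: field_simps)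
    qed
    also have "y * log 2 N + (\<delta> * log 2 N - K) = (1 / 2 - \<epsilon>) * log 2 N - K"
      by (simp add: \<delta>_def algebra_simps)
    also have "\<dots> \<le> avg_opt C N" unfolding N_def using \<open>n \<ge> n0\<close> by (rule bound)
    also have "\<dots> \<le> real (cost N C) / real N" by (rule avg_opt_le_cost)
    finally have "y \<le> real (cost N C) / (D * real N)"
      using \<open>D \<ge> 2\<close> N by (simp add: field_simps)
    then show "\<exists>N\<ge>N0. y \<le> real (cost N C) / ((real_of_int \<lfloor>log 2 (real N - 1)\<rfloor> + 2) * real N)"
      using N(1) unfolding D_def by blast
  qed
qed

theorem theorem7:
  fixes C :: "nat set"
  assumes "coin_set C" and "infinite C" and "completely_greedy C"
  shows "limsup (\<lambda>N::nat. ereal (real (cost N C) /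
           ((real_of_int \<lfloor>log 2 (real N - 1)\<rfloor> + 2) * real N))) \<ge> ereal (1 / 2)"
proof (rule ccontr)
  let ?f = "\<lambda>N. real (cost N C) / ((real_of_int \<lfloor>log 2 (real N - 1)\<rfloor> + 2) * real N)"
  assume "\<not> ?thesis"
  then have "limsup (\<lambda>N. ereal (?f N)) < ereal (1 / 2)" by simp
  \<comment> \<open>A real y strictly in between would eventually bound the ratio strictly from
    above, while the amounts N that are coins reach y arbitrarily far out.\<close>
  then obtain y where y: "limsup (\<lambda>N. ereal (?f N)) < ereal y" "ereal y < ereal (1 / 2)"
    using ereal_dense2 by blast
  from Limsup_lessD[OF y(1)] have "\<forall>\<^sub>F N in sequentially. \<not> y \<le> ?f N"
    by (rule eventually_mono) simp
  moreover have "\<exists>\<^sub>F N in sequentially. y \<le> ?f N"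
    using assms y(2) by (intro frequently_cost_ratio_ge) auto
  ultimately show False
    by (simp add: frequently_def)
qed

end
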